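(* Let $d\ge 1$, let $a^0,a^1\in\mathbb{R}^d$ have all entries strictly positive, and let $\mathcal{P}_0,\mathcal{P}_1\subset\mathbb{R}^d$ be the corresponding generalized cross polytopes, with associated polytope $\mathcal{D}\subset\mathbb{R}^{d+1}$ (all notation as in the context). Then the inequalities $$\sum_{i\in[d]}s_i\,\alpha_i(j)\,x_i+\bigl(M_0(j)-M_1(j)\bigr)z_1\le M_0(j)\qquad\text{for all }j\in[d],\ s\in\{\pm1\}^d,$$ together with $0\le z_1\le1$, give the convex hull $\mathcal{D}$; that is, $\mathcal{D}$ is exactly the set of all $(x,z_1)\in\mathbb{R}^d\times\mathbb{R}$ satisfying all of these inequalities.
   Context: $[d]:=\{1,\dots,d\}$. For $k\in\{0,1\}$, the generalized cross polytope is $\mathcal{P}_k:=\{x\in\mathbb{R}^d:\ \sum_{i\in[d]}s_i a^k_i x_i\le 1\text{ for all }s\in\{\pm1\}^d\}$, equivalently $\{x:\sum_{i}a^k_i|x_i|\le1\}$. The polytope $\mathcal{D}$ is the convex hull in $\mathbb{R}^{d+1}$ (points written $(x,z_1)$ with $x\in\mathbb{R}^d$, $z_1\in\mathbb{R}$) of $(\mathcal{P}_0\times\{0\})\cup(\mathcal{P}_1\times\{1\})$. For $j\in[d]$ let $r_j:=a^0_j/a^1_j$. For $i,j\in[d]$ define $\alpha_i(j):=a^0_i$ if $r_i<r_j$; $\alpha_i(j):=a^0_i=r_j a^1_i$ if $r_i=r_j$; and $\alpha_i(j):=r_j a^1_i$ if $r_i>r_j$. Define $M_0(j):=\max_{i\in[d]}\alpha_i(j)/a^0_i$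 and $M_1(j):=\max_{i\in[d]}\alpha_i(j)/a^1_i$. *)

theory Defs
  imports "HOL-Analysis.Analysis"
begin

text \<open>The index set \<open>[d]\<close> is rendered as a finite type \<open>'d\<close>, with \<open>d = CARD('d)\<close>;
  since types are nonempty, \<open>d \<ge> 1\<close> holds automatically.\<close>

definition sign_vectors :: "('d::finite \<Rightarrow> real) set" where
  "sign_vectors = {s. \<forall>i. s i = 1 \<or> s i = -1}"

definition cross_polytope :: "real ^ 'd::finite \<Rightarrow> (real ^ 'd) set" where
  "cross_polytope a = {x. \<forall>s\<in>sign_vectors. (\<Sum>i\<in>UNIV. s i * a $ i * x $ i) \<le> 1}"

definition cayley_hull :: "real ^ 'd::finite \<Rightarrow> real ^ 'd \<Rightarrow> ((real ^ 'd) \<times> real) set" where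
  "cayley_hull a0 a1 = convex hull (cross_polytope a0 \<times> {0} \<union> cross_polytope a1 \<times> {1})"

definition ratio :: "real ^ 'd::finite \<Rightarrow> real ^ 'd \<Rightarrow> 'd \<Rightarrow> real" where
  "ratio a0 a1 j = a0 $ j / a1 $ j"

text \<open>\<open>alpha a0 a1 j i\<close> is \<open>\<alpha>\<^sub>i(j)\<close>. In the case of equal ratios the two expressions
  \<open>a0 $ i\<close> and \<open>ratio a0 a1 j * a1 $ i\<close> coincide (for positive entries).\<close>

definition alpha :: "real ^ 'd::finite \<Rightarrow> real ^ 'd \<Rightarrow> 'd \<Rightarrow> 'd \<Rightarrow> real" where
  "alpha a0 a1 j i =
     (if ratio a0 a1 i < ratio a0 a1 j then a0 $ i
      else if ratio a0 a1 i = ratio a0 a1 j then a0 $ i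
      else ratio a0 a1 j * a1 $ i)"

definition M0 :: "real ^ 'd::finite \<Rightarrow> real ^ 'd \<Rightarrow> 'd \<Rightarrow> real" where
  "M0 a0 a1 j = Max (range (\<lambda>i. alpha a0 a1 j i / a0 $ i))"

definition M1 :: "real ^ 'd::finite \<Rightarrow> real ^ 'd \<Rightarrow> 'd \<Rightarrow> real" where
  "M1 a0 a1 j = Max (range (\<lambda>i. alpha a0 a1 j i / a1 $ i))"

end

theory Submission
  imports Defs
begin

text \<open>
  A point \<open>(x, z)\<close> lies in the hull iff \<open>x\<close> splits as \<open>u + v\<close> where \<open>u\<close> fits into the
  cross polytope \<open>P\<^sub>0\<close> scaled by \<open>1 - z\<close> and \<open>v\<close> into \<open>P\<^sub>1\<close> scaled by \<open>z\<close>
  (\<open>mem_cayley_hull_iff\<close>).  In terms of weighted \<open>l\<^sup>1\<close> norms this means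
  \<open>\<Sum>i. a0 i * \<bar>u i\<bar> \<le> 1 - z\<close> and \<open>\<Sum>i. a1 i * \<bar>v i\<bar> \<le> z\<close>.

  The coefficients simplify to \<open>\<alpha>\<^sub>i(j) = min (a0 i) (r\<^sub>j * a1 i)\<close>, and both maxima are attained
  at \<open>i = j\<close>, so \<open>M\<^sub>0(j) = 1\<close> and \<open>M\<^sub>1(j) = r\<^sub>j\<close>.  The inequalities for \<open>j\<close> thus amount to
  \<open>\<Sum>i. min (a0 i) (r\<^sub>j * a1 i) * \<bar>x i\<bar> \<le> (1 - z) + r\<^sub>j * z\<close>, and they follow from a splitting
  by adding the first norm bound to \<open>r\<^sub>j\<close> times the second.

  The converse is a fractional knapsack argument (\<open>ratio_threshold_split\<close>): each
  coordinate has cost \<open>a0 i * \<bar>x i\<bar>\<close> against the budget \<open>1 - z\<close> if it is put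
  into \<open>u\<close>, and cost \<open>a1 i * \<bar>x i\<bar>\<close> against the budget \<open>z\<close> if it is put into \<open>v\<close>.
  If the first budget suffices for all of \<open>x\<close>, take \<open>v = 0\<close>.  Otherwise fill \<open>u\<close> in order of
  increasing ratio \<open>r\<^sub>i = a0 i / a1 i\<close>, the price of a coordinate in \<open>u\<close> relative to its price
  in \<open>v\<close>, until its budget is exhausted, cutting the coordinates of the critical ratio \<open>r\<^sub>j\<close>
  proportionally.  All of \<open>u\<close> then has ratio at most \<open>r\<^sub>j\<close> and all of \<open>v\<close> ratio at least \<open>r\<^sub>j\<close>, so the left-hand side of the inequality for
  \<open>j\<close> is exactly the cost of \<open>u\<close>, which is \<open>1 - z\<close>, plus \<open>r\<^sub>j\<close> times the cost of \<open>v\<close>; hence that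
  single inequality says that the cost of \<open>v\<close> is at most \<open>z\<close>.
\<close>

section \<open>Cross polytopes as weighted norm balls\<close>

text \<open>The signs that agree with those of \<open>x\<close> give the largest of the left-hand sides.\<close>

lemma all_signs_le_iff_weighted_l1_le:
  fixes x :: "real ^ 'd::finite"
  assumes w: "\<And>i. 0 \<le> w i"
  shows "(\<forall>s\<in>sign_vectors. (\<Sum>i\<in>UNIV. s i * w i * x $ i) \<le> c)
     \<longleftrightarrow> (\<Sum>i\<in>UNIV. w i * \<bar>x $ i\<bar>) \<le> c"
proof
  assume all: "\<forall>s\<in>sign_vectors. (\<Sum>i\<in>UNIV. s i * w i * x $ i) \<le> c"
  define s where "s = (\<lambda>i. if 0 \<le> x $ i then 1 else - 1 :: real)"
  have "s \<in> sign_vectors"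
    by (auto simp: s_def sign_vectors_def)
  with all have "(\<Sum>i\<in>UNIV. s i * w i * x $ i) \<le> c"
    by blast
  moreover have "s i * w i * x $ i = w i * \<bar>x $ i\<bar>" for i
    by (auto simp: s_def)
  ultimately show "(\<Sum>i\<in>UNIV. w i * \<bar>x $ i\<bar>) \<le> c"
    by simp
next
  assume le: "(\<Sum>i\<in>UNIV. w i * \<bar>x $ i\<bar>) \<le> c"
  show "\<forall>s\<in>sign_vectors. (\<Sum>i\<in>UNIV. s i * w i * x $ i) \<le> c"
  proof
    fix s :: "'d \<Rightarrow> real"
    assume s: "s \<in> sign_vectors"
    have "s i * w i * x $ i \<le> w i * \<bar>x $ i\<bar>" for i
    proof -
      have "s i * x $ i \<le> \<bar>x $ i\<bar>"
        using s by (auto simp: sign_vectors_def dest: spec[of _ i])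
      then have "w i * (s i * x $ i) \<le> w i * \<bar>x $ i\<bar>"
        using w by (intro mult_left_mono)
      then show ?thesis
        by (simp add: mult_ac)
    qed
    then have "(\<Sum>i\<in>UNIV. s i * w i * x $ i) \<le> (\<Sum>i\<in>UNIV. w i * \<bar>x $ i\<bar>)"
      by (intro sum_mono)
    with le show "(\<Sum>i\<in>UNIV. s i * w i * x $ i) \<le> c"
      by linarith
  qed
qed

lemma mem_cross_polytope_iff:
  fixes a :: "real ^ 'd::finite"
  assumes "\<And>i. 0 < a $ i"
  shows "x \<in> cross_polytope a \<longleftrightarrow> (\<Sum>i\<in>UNIV. a $ i * \<bar>x $ i\<bar>) \<le> 1"
  unfolding cross_polytope_def
  using all_signs_le_iff_weighted_l1_le[of "\<lambda>i. a $ i" x 1] assms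
  by (simp add: less_imp_le)

lemma convex_cross_polytope: "convex (cross_polytope a)"
proof -
  have "cross_polytope a = (\<Inter>s\<in>sign_vectors. {x. (\<chi> i. s i * a $ i) \<bullet> x \<le> 1})"
    by (auto simp: cross_polytope_def inner_vec_def)
  then show ?thesis
    by (simp add: convex_INT convex_halfspace_le)
qed

text \<open>For \<open>c = 0\<close> this needs all weights to be positive, so that only \<open>0\<close> has norm \<open>0\<close>.\<close>

lemma mem_scaled_cross_polytope_iff:
  fixes a :: "real ^ 'd::finite"
  assumes a: "\<And>i. 0 < a $ i" and c: "0 \<le> c"
  shows "(\<exists>p\<in>cross_polytope a. w = c *\<^sub>R p) \<longleftrightarrow> (\<Sum>i\<in>UNIV. a $ i * \<bar>w $ i\<bar>) \<le> c"
proof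
  assume "\<exists>p\<in>cross_polytope a. w = c *\<^sub>R p"
  then obtain p where p: "(\<Sum>i\<in>UNIV. a $ i * \<bar>p $ i\<bar>) \<le> 1" and w: "w = c *\<^sub>R p"
    using mem_cross_polytope_iff[OF a] by blast
  have "(\<Sum>i\<in>UNIV. a $ i * \<bar>w $ i\<bar>) = c * (\<Sum>i\<in>UNIV. a $ i * \<bar>p $ i\<bar>)"
    using c by (simp add: w abs_mult sum_distrib_left mult_ac)
  with p c show "(\<Sum>i\<in>UNIV. a $ i * \<bar>w $ i\<bar>) \<le> c"
    by (simp add: mult_left_le)
next
  assume le: "(\<Sum>i\<in>UNIV. a $ i * \<bar>w $ i\<bar>) \<le> c"
  show "\<exists>p\<in>cross_polytope a. w = c *\<^sub>R p"
  proof (cases "c = 0")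
    case True
    have nonneg: "0 \<le> a $ i * \<bar>w $ i\<bar>" for i
      using a[of i] by simp
    with le True have "(\<Sum>i\<in>UNIV. a $ i * \<bar>w $ i\<bar>) = 0"
      by (simp add: order_antisym sum_nonneg)
    with nonneg have "a $ i * \<bar>w $ i\<bar> = 0" for i
      by (simp add: sum_nonneg_eq_0_iff)
    then have "w $ i = 0" for i
      using a[of i] by (metis abs_eq_0 mult_eq_0_iff less_irrefl)
    then have "w = c *\<^sub>R 0"
      by (simp add: vec_eq_iff)
    moreover have "0 \<in> cross_polytope a"
      by (simp add: mem_cross_polytope_iff[OF a])
    ultimately show ?thesis
      by blast
  next
    case False
    with c have pos: "0 < c"
      by simp
    have "(\<Sum>i\<in>UNIV. a $ i * \<bar>((1 / c) *\<^sub>R w) $ i\<bar>) = (\<Sum>i\<in>UNIV. a $ i * \<bar>w $ i\<bar>) / c"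
      using pos by (simp add: abs_mult sum_divide_distrib)
    also have "\<dots> \<le> 1"
      using le pos by simp
    finally have "(1 / c) *\<^sub>R w \<in> cross_polytope a"
      by (simp add: mem_cross_polytope_iff[OF a])
    moreover have "w = c *\<^sub>R ((1 / c) *\<^sub>R w)"
      using pos by simp
    ultimately show ?thesis
      by blast
  qed
qed

section \<open>The hull as a set of splittings\<close>

lemma mem_cayley_hull_iff:
  fixes a0 a1 :: "real ^ 'd::finite"
  assumes a0: "\<And>i. 0 < a0 $ i" and a1: "\<And>i. 0 < a1 $ i"
  shows "(x, z) \<in> cayley_hull a0 a1 \<longleftrightarrow> 0 \<le> z \<and> z \<le> 1 \<and>
    (\<exists>u v. x = u + v \<and> (\<Sum>i\<in>UNIV. a0 $ i * \<bar>u $ i\<bar>) \<le> 1 - z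
                     \<and> (\<Sum>i\<in>UNIV. a1 $ i * \<bar>v $ i\<bar>) \<le> z)"
proof -
  let ?A = "cross_polytope a0 \<times> {0::real}" and ?B = "cross_polytope a1 \<times> {1::real}"
  have "0 \<in> cross_polytope a0" "0 \<in> cross_polytope a1"
    by (simp_all add: mem_cross_polytope_iff a0 a1)
  then have hull: "convex hull (?A \<union> ?B) =
      {s *\<^sub>R p + t *\<^sub>R q | s t p q. 0 \<le> s \<and> 0 \<le> t \<and> s + t = 1 \<and> p \<in> ?A \<and> q \<in> ?B}"
    by (subst convex_hull_union_two) (auto simp: convex_Times convex_cross_polytope)
  have "(x, z) \<in> cayley_hull a0 a1 \<longleftrightarrow> (\<exists>s t. \<exists>p\<in>cross_polytope a0. \<exists>q\<in>cross_polytope a1.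
      0 \<le> s \<and> 0 \<le> t \<and> s + t = 1 \<and> x = s *\<^sub>R p + t *\<^sub>R q \<and> z = t)"
    unfolding cayley_hull_def hull by fastforce
  also have "\<dots> \<longleftrightarrow> 0 \<le> z \<and> z \<le> 1 \<and>
      (\<exists>p\<in>cross_polytope a0. \<exists>q\<in>cross_polytope a1. x = (1 - z) *\<^sub>R p + z *\<^sub>R q)"
    (is "?L \<longleftrightarrow> ?R")
  proof
    assume ?L
    then obtain s p q where "p \<in> cross_polytope a0" "q \<in> cross_polytope a1"
      "0 \<le> s" "0 \<le> z" "s + z = 1" "x = s *\<^sub>R p + z *\<^sub>R q"
      by blast
    moreover from this have "s = 1 - z"
      by simp
    ultimately show ?R
      by auto
  next
    assume ?R
    moreover from this have "0 \<le> 1 - z" "(1 - z) + z = 1"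
      by simp_all
    ultimately show ?L
      by blast
  qed
  also have "\<dots> \<longleftrightarrow> 0 \<le> z \<and> z \<le> 1 \<and>
      (\<exists>u v. x = u + v \<and> (\<exists>p\<in>cross_polytope a0. u = (1 - z) *\<^sub>R p)
                       \<and> (\<exists>q\<in>cross_polytope a1. v = z *\<^sub>R q))"
    by blast
  finally show ?thesis
    by (simp add: mem_scaled_cross_polytope_iff a0 a1 cong: conj_cong)
qed

section \<open>The coefficients of the inequalities\<close>

lemma alpha_eq_min:
  assumes "\<And>i. 0 < a1 $ i"
  shows "alpha a0 a1 j i = min (a0 $ i) (ratio a0 a1 j * a1 $ i)"
proof -
  have "a0 $ i = ratio a0 a1 i * a1 $ i"
    using assms[of i] by (simp add: ratio_def)
  then show ?thesis
    using assms[of i] by (auto simp: alpha_def min_def mult_le_cancel_right)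
qed

lemma M0_eq_1:
  assumes a0: "\<And>i. 0 < a0 $ i" and a1: "\<And>i. 0 < a1 $ i"
  shows "M0 a0 a1 j = 1"
  unfolding M0_def
proof (rule Max_eqI)
  fix y
  assume "y \<in> range (\<lambda>i. alpha a0 a1 j i / a0 $ i)"
  then obtain i where "y = alpha a0 a1 j i / a0 $ i"
    by blast
  then show "y \<le> 1"
    using a0[of i] by (simp add: alpha_eq_min[OF a1])
next
  have "alpha a0 a1 j j / a0 $ j = 1"
    using a0[of j] by (simp add: alpha_def)
  then show "1 \<in> range (\<lambda>i. alpha a0 a1 j i / a0 $ i)"
    using rangeI[of "\<lambda>i. alpha a0 a1 j i / a0 $ i" j] by simp
qed simp

lemma M1_eq_ratio:
  assumes a1: "\<And>i. 0 < a1 $ i"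
  shows "M1 a0 a1 j = ratio a0 a1 j"
  unfolding M1_def
proof (rule Max_eqI)
  fix y
  assume "y \<in> range (\<lambda>i. alpha a0 a1 j i / a1 $ i)"
  then obtain i where "y = alpha a0 a1 j i / a1 $ i"
    by blast
  then show "y \<le> ratio a0 a1 j"
    using a1[of i] by (simp add: alpha_eq_min[OF a1] pos_divide_le_eq)
next
  have "alpha a0 a1 j j / a1 $ j = ratio a0 a1 j"
    by (simp add: alpha_def ratio_def)
  then show "ratio a0 a1 j \<in> range (\<lambda>i. alpha a0 a1 j i / a1 $ i)"
    using rangeI[of "\<lambda>i. alpha a0 a1 j i / a1 $ i" j] by simp
qed simp

section \<open>Splitting at a critical ratio\<close>

text \<open>
  Going through the items \<open>i\<close> in the order of a key \<open>r\<close> and adding up costs \<open>f i\<close>,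
  the budget \<open>b\<close> is first exceeded at some key \<open>r j\<close>; a fraction \<open>t\<close> of the items with that
  key then uses it up exactly.  Items with equal keys are cut together, so that the order
  need not be made linear.
\<close>

lemma budget_threshold:
  fixes r f :: "'d::finite \<Rightarrow> real"
  assumes b: "0 \<le> b" and exceeds: "b < sum f UNIV"
  obtains j t where "0 \<le> t" "t \<le> 1"
    and "sum f {i. r i < r j} + t * sum f {i. r i = r j} = b"
proof -
  define C where "C = {j. b < sum f {i. r i \<le> r j}}"
  obtain m where "\<And>i. r i \<le> r m"
    using ex_is_arg_min_if_finite[of UNIV "\<lambda>i. - r i"] by (auto simp: is_arg_min_linorder)
  then have "m \<in> C"
    using exceeds by (simp add: C_def)
  then have "finite C" "C \<noteq> {}"
    by auto
  then obtain j where j: "j \<in> C" and least: "\<And>i. i \<in> C \<Longrightarrow> r j \<le> r i"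
    using ex_is_arg_min_if_finite[of C r] by (auto simp: is_arg_min_linorder)
  let ?L = "sum f {i. r i < r j}" and ?E = "sum f {i. r i = r j}"
  have "{i. r i \<le> r j} = {i. r i < r j} \<union> {i. r i = r j}"
    by auto
  then have "sum f {i. r i \<le> r j} = ?L + ?E"
    by (auto intro: sum.union_disjoint)
  then have gt: "b < ?L + ?E"
    using j by (simp add: C_def)
  have le: "?L \<le> b"
  proof (cases "{i. r i < r j} = {}")
    case True
    then have "?L = 0"
      by (simp only: sum.empty)
    with b show ?thesis
      by simp
  next
    case False
    \<comment> \<open>The items below \<open>r j\<close> are those up to the next smaller key \<open>r l\<close>.\<close>
    then obtain l where l: "r l < r j" and greatest: "\<And>i. r i < r j \<Longrightarrow> r i \<le> r l"
      using ex_is_arg_min_if_finite[of "{i. r i < r j}" "\<lambda>i. - r i"]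
      by (auto simp: is_arg_min_linorder)
    then have "{i. r i \<le> r l} = {i. r i < r j}"
      by force
    moreover have "l \<notin> C"
      using least[of l] l by auto
    ultimately show ?thesis
      by (simp add: C_def)
  qed
  have E: "0 < ?E"
    using gt le by linarith
  show ?thesis
  proof
    show "0 \<le> (b - ?L) / ?E"
      using le E by simp
    show "(b - ?L) / ?E \<le> 1"
      using gt E by simp
    show "?L + (b - ?L) / ?E * ?E = b"
      using E by simp
  qed
qed

text \<open>
  The threshold \<open>j\<close> splits \<open>x\<close> into \<open>u\<close>, living on the ratios up to \<open>r\<^sub>j\<close>, and \<open>v\<close>, living on the
  ratios from \<open>r\<^sub>j\<close> on.  On the former the minimum is \<open>a0 $ i\<close>, on the latter it is
  \<open>r\<^sub>j * a1 $ i\<close>, so the bound for \<open>j\<close> separates into the two costs.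
\<close>

lemma ratio_threshold_split:
  fixes a0 a1 x :: "real ^ 'd::finite"
  assumes a0: "\<And>i. 0 < a0 $ i" and a1: "\<And>i. 0 < a1 $ i"
    and z: "0 \<le> z" "z \<le> 1"
    and bound: "\<And>j. (\<Sum>i\<in>UNIV. min (a0 $ i) (ratio a0 a1 j * a1 $ i) * \<bar>x $ i\<bar>)
                       \<le> 1 - z + ratio a0 a1 j * z"
  obtains u v where "x = u + v"
    and "(\<Sum>i\<in>UNIV. a0 $ i * \<bar>u $ i\<bar>) \<le> 1 - z"
    and "(\<Sum>i\<in>UNIV. a1 $ i * \<bar>v $ i\<bar>) \<le> z"
proof (cases "(\<Sum>i\<in>UNIV. a0 $ i * \<bar>x $ i\<bar>) \<le> 1 - z")
  case True
  with z that[of x 0] show ?thesis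
    by simp
next
  case False
  define r where "r = ratio a0 a1"
  define f where "f = (\<lambda>i. a0 $ i * \<bar>x $ i\<bar>)"
  have "0 \<le> 1 - z" "1 - z < sum f UNIV"
    using False z by (simp_all add: f_def)
  then obtain j t where t: "0 \<le> t" "t \<le> 1"
    and budget: "sum f {i. r i < r j} + t * sum f {i. r i = r j} = 1 - z"
    by (rule budget_threshold)
  define share where "share = (\<lambda>i. if r i < r j then 1 else if r i = r j then t else 0)"
  define u where "u = (\<chi> i. share i * x $ i)"
  define v where "v = (\<chi> i. (1 - share i) * x $ i)"
  have share: "0 \<le> share i" "share i \<le> 1" for i
    using t by (auto simp: share_def)
  have rj: "0 < r j"
    using a0 a1 by (simp add: r_def ratio_def)
  have u_cost: "(\<Sum>i\<in>UNIV. a0 $ i * \<bar>u $ i\<bar>) = 1 - z"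
  proof -
    have "a0 $ i * \<bar>u $ i\<bar> = (if r i < r j then f i else 0) + (if r i = r j then t * f i else 0)"
      for i
      using t by (simp add: u_def share_def f_def abs_mult)
    then have "(\<Sum>i\<in>UNIV. a0 $ i * \<bar>u $ i\<bar>) =
        sum f {i. r i < r j} + t * sum f {i. r i = r j}"
      by (simp add: sum.distrib sum.If_cases sum_distrib_left)
    with budget show ?thesis
      by simp
  qed
  have split: "min (a0 $ i) (r j * a1 $ i) * \<bar>x $ i\<bar> = a0 $ i * \<bar>u $ i\<bar> + r j * (a1 $ i * \<bar>v $ i\<bar>)"
    for i
  proof -
    have a0_eq: "a0 $ i = r i * a1 $ i"
      using a1[of i] by (simp add: r_def ratio_def)
    have "min (a0 $ i) (r j * a1 $ i) = a0 $ i * share i + r j * a1 $ i * (1 - share i)"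
      using a1[of i] by (auto simp: a0_eq min_def share_def mult_le_cancel_right algebra_simps)
    moreover have "\<bar>u $ i\<bar> = share i * \<bar>x $ i\<bar>" "\<bar>v $ i\<bar> = (1 - share i) * \<bar>x $ i\<bar>"
      using share[of i] by (simp_all add: u_def v_def abs_mult)
    ultimately show ?thesis
      by (simp only:) (simp add: algebra_simps)
  qed
  have "(1 - z) + r j * (\<Sum>i\<in>UNIV. a1 $ i * \<bar>v $ i\<bar>) \<le> 1 - z + r j * z"
    using bound[of j] by (simp add: split sum.distrib u_cost flip: r_def sum_distrib_left)
  then have "(\<Sum>i\<in>UNIV. a1 $ i * \<bar>v $ i\<bar>) \<le> z"
    using rj by simp
  moreover have "x = u + v"
    by (simp add: u_def v_def vec_eq_iff algebra_simps)
  ultimately show ?thesis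
    using that u_cost by simp
qed

section \<open>The inequalities and the hull\<close>

lemma min_weighted_l1_split_le:
  fixes a0 a1 u v :: "real ^ 'd::finite"
  assumes a0: "\<And>i. 0 < a0 $ i" and a1: "\<And>i. 0 < a1 $ i" and c: "0 < c"
  shows "(\<Sum>i\<in>UNIV. min (a0 $ i) (c * a1 $ i) * \<bar>(u + v) $ i\<bar>)
    \<le> (\<Sum>i\<in>UNIV. a0 $ i * \<bar>u $ i\<bar>) + c * (\<Sum>i\<in>UNIV. a1 $ i * \<bar>v $ i\<bar>)"
proof -
  have "min (a0 $ i) (c * a1 $ i) * \<bar>(u + v) $ i\<bar> \<le> a0 $ i * \<bar>u $ i\<bar> + c * a1 $ i * \<bar>v $ i\<bar>" for i
  proof -
    let ?m = "min (a0 $ i) (c * a1 $ i)"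
    have "0 \<le> ?m"
      using a0[of i] a1[of i] c by simp
    then have "?m * \<bar>(u + v) $ i\<bar> \<le> ?m * (\<bar>u $ i\<bar> + \<bar>v $ i\<bar>)"
      by (intro mult_left_mono) simp_all
    also have "\<dots> = ?m * \<bar>u $ i\<bar> + ?m * \<bar>v $ i\<bar>"
      by (rule distrib_left)
    also have "\<dots> \<le> a0 $ i * \<bar>u $ i\<bar> + c * a1 $ i * \<bar>v $ i\<bar>"
      by (intro add_mono mult_right_mono) simp_all
    finally show ?thesis .
  qed
  then have "(\<Sum>i\<in>UNIV. min (a0 $ i) (c * a1 $ i) * \<bar>(u + v) $ i\<bar>)
      \<le> (\<Sum>i\<in>UNIV. a0 $ i * \<bar>u $ i\<bar> + c * a1 $ i * \<bar>v $ i\<bar>)"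
    by (intro sum_mono)
  then show ?thesis
    by (simp add: sum.distrib sum_distrib_left mult.assoc)
qed

theorem theorem13:
  fixes a0 a1 :: "real ^ 'd::finite"
  assumes "\<And>i. a0 $ i > 0" and "\<And>i. a1 $ i > 0"
  shows "cayley_hull a0 a1 =
    {(x, z). (\<forall>j. \<forall>s\<in>sign_vectors.
                (\<Sum>i\<in>UNIV. s i * alpha a0 a1 j i * x $ i) + (M0 a0 a1 j - M1 a0 a1 j) * z
                  \<le> M0 a0 a1 j)
             \<and> 0 \<le> z \<and> z \<le> 1}"
proof -
  have ratio_pos: "0 < ratio a0 a1 j" for j
    using assms by (simp add: ratio_def)
  have alpha_nonneg: "0 \<le> alpha a0 a1 j i" for i j
    using assms(1)[of i] assms(2)[of i] ratio_pos[of j] by (simp add: alpha_eq_min[OF assms(2)])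
  have ineq_iff: "(\<forall>s\<in>sign_vectors.
        (\<Sum>i\<in>UNIV. s i * alpha a0 a1 j i * x $ i) + (M0 a0 a1 j - M1 a0 a1 j) * z \<le> M0 a0 a1 j)
      \<longleftrightarrow> (\<Sum>i\<in>UNIV. min (a0 $ i) (ratio a0 a1 j * a1 $ i) * \<bar>x $ i\<bar>) \<le> 1 - z + ratio a0 a1 j * z"
    for j x z
  proof -
    have "S + (M0 a0 a1 j - M1 a0 a1 j) * z \<le> M0 a0 a1 j
        \<longleftrightarrow> S \<le> 1 - z + ratio a0 a1 j * z" for S
      by (simp add: M0_eq_1[OF assms] M1_eq_ratio[OF assms(2)] algebra_simps)
    then show ?thesis
      using all_signs_le_iff_weighted_l1_le[of "alpha a0 a1 j" x "1 - z + ratio a0 a1 j * z"]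
        alpha_nonneg
      by (simp add: alpha_eq_min[OF assms(2)])
  qed
  have mem_iff: "(x, z) \<in> cayley_hull a0 a1 \<longleftrightarrow>
      (\<forall>j. (\<Sum>i\<in>UNIV. min (a0 $ i) (ratio a0 a1 j * a1 $ i) * \<bar>x $ i\<bar>)
              \<le> 1 - z + ratio a0 a1 j * z) \<and> 0 \<le> z \<and> z \<le> 1"
    (is "_ \<longleftrightarrow> ?R") for x z
  proof
    assume "(x, z) \<in> cayley_hull a0 a1"
    then obtain u v where z: "0 \<le> z" "z \<le> 1" and x: "x = u + v"
      and u: "(\<Sum>i\<in>UNIV. a0 $ i * \<bar>u $ i\<bar>) \<le> 1 - z"
      and v: "(\<Sum>i\<in>UNIV. a1 $ i * \<bar>v $ i\<bar>) \<le> z"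
      using mem_cayley_hull_iff[OF assms] by blast
    have "(\<Sum>i\<in>UNIV. min (a0 $ i) (ratio a0 a1 j * a1 $ i) * \<bar>x $ i\<bar>)
        \<le> 1 - z + ratio a0 a1 j * z" for j
    proof -
      have "ratio a0 a1 j * (\<Sum>i\<in>UNIV. a1 $ i * \<bar>v $ i\<bar>) \<le> ratio a0 a1 j * z"
        using v ratio_pos[of j] by simp
      with u min_weighted_l1_split_le[OF assms ratio_pos, of j u v] show ?thesis
        unfolding x by linarith
    qed
    with z show ?R
      by blast
  next
    assume R: ?R
    then obtain u v where "x = u + v" "(\<Sum>i\<in>UNIV. a0 $ i * \<bar>u $ i\<bar>) \<le> 1 - z"
      "(\<Sum>i\<in>UNIV. a1 $ i * \<bar>v $ i\<bar>) \<le> z"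
      using ratio_threshold_split[OF assms, of z x] by blast
    with R show "(x, z) \<in> cayley_hull a0 a1"
      using mem_cayley_hull_iff[OF assms] by blast
  qed
  show ?thesis
    unfolding ineq_iff by (auto simp: mem_iff)
qed

end
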